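(* Let $(\sigma_n)_{n\ge1}$ be an exponentially concentrated random sofic approximation to the free group $\Gamma$ and let $\mathtt A$ be a finite alphabet. For every $\mu\in\mathrm{Prob}^\Gamma(\mathtt{A}^\Gamma)$, $h^\sharp(\mu)\le\overline{\mathrm h}^{\mathrm{ann}}(\mu)$ and $h^\flat(\mu)\le\underline{\mathrm h}^{\mathrm{ann}}(\mu)$.
   Context: $\Gamma$ is the free group of rank $r$ with free generators $s_1,\dots,s_r$ and identity $e$; $d(\gamma,e)$ is word length. $\Gamma$ acts on $\mathtt{A}^\Gamma$ by $(g\cdot x)(h)=x(hg)$; $\mathrm{Prob}^\Gamma(\mathtt{A}^\Gamma)$ is the set of shift-invariant Borel probability measures. For a finite set $V$, $\sigma\in\mathrm{Hom}(\Gamma,\mathrm{Sym}(V))$ and $x\in\mathtt{A}^V$, let $(\Pi_v^\sigma x)(h)=x(\sigma^h v)$ and $P_x^\sigma=\frac1{|V|}\sum_{v\in V}\delta_{\Pi_v^\sigma x}$. Give $\mathtt{A}^\Gamma$ the metric $d(x,y)=\sum_{\gamma}\mathbf 1_{\{x(\gamma)\ne y(\gamma)\}}(5r^2)^{-d(\gamma,e)}$ and $\mathrm{Prob}^\Gamma(\mathtt{A}^\Gamma)$ the transportation metric $\overline d(\mu,\nu)=\sup\{|\int f\,d\mu-\int f\,d\nu| : f\text{ real-valued 1-Lipschitz}\}$. Let $\Omega(\sigma,\mu,\varepsilon)=\{x\in\mathtt{A}^V:\overline d(P_x^\sigma,\mu)<\varepsilon\}$. $\sigma$ is $(F,\delta)$-sofic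 ($F\subset\Gamma$ finite, $\delta>0$) if $\frac1{|V|}|\{v:\sigma(\gamma_1)v\ne\sigma(\gamma_2)v\text{ for all distinct }\gamma_1,\gamma_2\in F\}|>1-\delta$. A random sofic approximation is a sequence of random $\sigma_n\in\mathrm{Hom}(\Gamma,\mathrm{Sym}(V_n))$, $V_n$ finite, such that for every $(F,\delta)$, $\limsup_n\frac1{|V_n|}\log\mathbb{P}\{\sigma_n\text{ not }(F,\delta)\text{-sofic}\}=-\infty$. $\sigma_1,\sigma_2\in\mathrm{Hom}(\Gamma,\mathrm{Sym}(V))$ differ by a switching if for some $i,j\in V$, $k\in\{1,\dots,r\}$, $\sigma_1^{s_k}(i)=\sigma_2^{s_k}(j)$, $\sigma_1^{s_k}(j)=\sigma_2^{s_k}(i)$, and the generator permutations are otherwise identical; $d(\sigma_1,\sigma_2)=m/|V|$ with $m$ the minimal number of switchings from $\sigma_1$ to $\sigma_2$. The sequence is exponentially concentrated if for some $C>0$, for all $n$, all 1-Lipschitz $f\colon\mathrm{Hom}(\Gamma,\mathrm{Sym}(V_n))\to\mathbb{R}$ and $t>0$, $\mathbb{P}\{|f(\sigma_n)-\mathbb{E}f(\sigma_n)|>t\}\le2e^{-C|V_n|t^2}$. Annealed entropies: $\overline{\mathrm h}^{\mathrm{ann}}(\mu)=\inf_{\varepsilon>0}\limsup_n\frac1{|V_n|}\log\mathbb{E}|\Omega(\sigma_n,\mu,\varepsilon)|$, $\underline{\mathrm h}^{\mathrm{ann}}(\mu)=\inf_{\varepsilon>0}\liminf_n\frac1{|V_n|}\log\mathbb{E}|\Omega(\sigma_n,\mu,\varepsilon)|$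 (with $\log0=-\infty$). For $h\in[0,\log|\mathtt{A}|]$ let $\rho_\mu(\sigma,h)=\inf\{\varepsilon>0:\frac1{|V|}\log|\Omega(\sigma,\mu,\varepsilon)|\ge h\}$, $\overline\rho_\mu(h)=\limsup_n\mathbb{E}\rho_\mu(\sigma_n,h)$, $\underline\rho_\mu(h)=\liminf_n\mathbb{E}\rho_\mu(\sigma_n,h)$. Then $h^\flat(\mu)=\sup\{h\in[0,\log|\mathtt A|]:\overline\rho_\mu(h)=0\}$, $h^\sharp(\mu)=\sup\{h\in[0,\log|\mathtt A|]:\underline\rho_\mu(h)=0\}$, with $\sup\varnothing=-\infty$. *)

theory Defs
  imports "HOL-Probability.Probability" "HOL-Algebra.Bij"
begin

text \<open>
  The free group on the generator type \<open>'r\<close>: words in the letters \<open>(k, True)\<close> for \<open>s\<^sub>k\<close> and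
  \<open>(k, False)\<close> for its inverse, modulo insertion and cancellation of adjacent inverse letters.
  The rank is \<open>CARD('r)\<close> for \<open>'r :: finite\<close>.
\<close>

inductive free_eq :: "('r \<times> bool) list \<Rightarrow> ('r \<times> bool) list \<Rightarrow> bool" where
  cancel: "free_eq (u @ [(k, b), (k, \<not> b)] @ v) (u @ v)"
| refl: "free_eq u u"
| sym: "free_eq u v \<Longrightarrow> free_eq v u"
| trans: "free_eq u v \<Longrightarrow> free_eq v w \<Longrightarrow> free_eq u w"

lemma free_eq_context: "free_eq u v \<Longrightarrow> free_eq (a @ u @ b) (a @ v @ b)"
proof (induction rule: free_eq.induct)
  case (cancel u k c v)
  show ?case using free_eq.cancel[of "a @ u" k c "v @ b"] by simp
qed (auto intro: free_eq.intros)

lemma free_eq_append: "free_eq u u' \<Longrightarrow> free_eq v v' \<Longrightarrow> free_eq (u @ v) (u' @ v')"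
  using free_eq_context[of u u' "[]" v] free_eq_context[of v v' u' "[]"]
  by (auto intro: free_eq.trans)

quotient_type 'r free_group = "('r \<times> bool) list" / free_eq
  by (rule equivpI)
    (auto simp: reflp_def symp_def transp_def intro: free_eq.refl free_eq.sym free_eq.trans)

instantiation free_group :: (type) monoid_mult
begin

lift_definition one_free_group :: "'a free_group" is "[]" .

lift_definition times_free_group :: "'a free_group \<Rightarrow> 'a free_group \<Rightarrow> 'a free_group" is "(@)"
  by (rule free_eq_append)

instance
  by standard (transfer; simp add: free_eq.refl)+

end

definition gen :: "'r \<Rightarrow> 'r free_group" where
  "gen k = abs_free_group [(k, True)]"

definition free_grp :: "'r free_group monoid" where
  "free_grp = \<lparr>carrier = UNIV, mult = (*), one = 1\<rparr>"

lemma free_eq_inverse: "free_eq (map (\<lambda>(k, b). (k, \<not> b)) (rev w) @ w) []"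
proof (induction w)
  case Nil
  show ?case by (simp add: free_eq.refl)
next
  case (Cons l w)
  obtain k b where l: "l = (k, b)" by (cases l)
  have "free_eq (map (\<lambda>(k, b). (k, \<not> b)) (rev w) @ [(k, \<not> b), (k, \<not> \<not> b)] @ w)
    (map (\<lambda>(k, b). (k, \<not> b)) (rev w) @ w)"
    by (rule free_eq.cancel)
  with Cons show ?case by (auto simp: l intro: free_eq.trans)
qed

lemma group_free_grp: "group (free_grp :: 'r free_group monoid)"
proof (rule groupI)
  fix x :: "'r free_group"
  have "\<exists>y. y * x = 1"
    by transfer (meson free_eq_inverse)
  then show "\<exists>y\<in>carrier free_grp. y \<otimes>\<^bsub>free_grp\<^esub> x = \<one>\<^bsub>free_grp\<^esub>"
    by (auto simp: free_grp_def)
qed (auto simp: free_grp_def mult.assoc)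

text \<open>The universal property, confirming that the quotient above is free on \<open>gen\<close>.\<close>

lemma free_grp_universal:
  fixes G (structure) and f :: "'r \<Rightarrow> 'g"
  assumes "group G" and f: "\<And>k. f k \<in> carrier G"
  shows "\<exists>!\<phi>. \<phi> \<in> hom free_grp G \<and> (\<forall>k. \<phi> (gen k) = f k)"
proof -
  interpret group G by fact
  define letter where "letter = (\<lambda>(k, b). if b then f k else inv (f k))"
  define ev where "ev = (\<lambda>w. foldr (\<lambda>l x. letter l \<otimes> x) w \<one>)"
  have letter_closed [simp]: "letter l \<in> carrier G" for l
    using f by (cases l) (auto simp: letter_def)
  have ev_closed [simp]: "ev w \<in> carrier G" for w
    by (induction w) (auto simp: ev_def)
  have ev_Nil [simp]: "ev [] = \<one>" by (simp add: ev_def)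
  have ev_Cons [simp]: "ev (l # w) = letter l \<otimes> ev w" for l w by (simp add: ev_def)
  have ev_append [simp]: "ev (u @ v) = ev u \<otimes> ev v" for u v
    by (induction u) (auto simp: m_assoc)
  have letter_cancel: "letter (k, b) \<otimes> (letter (k, \<not> b) \<otimes> x) = x"
    if "x \<in> carrier G" for k b x
    using f[of k] that by (auto simp: letter_def m_assoc[symmetric])
  have ev_resp: "ev u = ev v" if "free_eq u v" for u v
    using that by induction (auto simp: letter_cancel)
  define \<phi> where "\<phi> = (\<lambda>\<gamma>. ev (rep_free_group \<gamma>))"
  have \<phi>_abs: "\<phi> (abs_free_group w) = ev w" for w
    unfolding \<phi>_def
    by (rule ev_resp) (metis Quotient_free_group Quotient_rep_abs free_eq.refl)
  have \<phi>_mult: "\<phi> (x * y) = \<phi> x \<otimes> \<phi> y" for x y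
    by (induction x; induction y) (simp add: times_free_group.abs_eq \<phi>_abs)
  show ?thesis
  proof (rule ex1I[of _ \<phi>])
    show "\<phi> \<in> hom free_grp G \<and> (\<forall>k. \<phi> (gen k) = f k)"
      using f by (auto simp: hom_def free_grp_def \<phi>_mult gen_def \<phi>_abs letter_def)
        (simp add: \<phi>_def)
  next
    fix \<psi> assume \<psi>: "\<psi> \<in> hom free_grp G \<and> (\<forall>k. \<psi> (gen k) = f k)"
    have mult: "\<psi> (x * y) = \<psi> x \<otimes> \<psi> y" for x y
      using \<psi> by (auto simp: hom_def free_grp_def)
    have closed: "\<psi> x \<in> carrier G" for x
      using \<psi> by (auto simp: hom_def free_grp_def)
    have one: "\<psi> 1 = \<one>"
      using mult[of 1 1] closed[of 1] by (metis l_cancel_one' mult_1)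
    have letter: "\<psi> (abs_free_group [l]) = letter l" for l
    proof (cases l)
      case (Pair k b)
      have "abs_free_group [(k, False)] * gen k = 1"
        using free_eq.cancel[of "[]" k False "[]"]
        by (simp add: gen_def times_free_group.abs_eq one_free_group.abs_eq free_group.abs_eq_iff)
      then have "\<psi> (abs_free_group [(k, False)]) \<otimes> f k = \<one>"
        using mult \<psi> one by metis
      then have "\<psi> (abs_free_group [(k, False)]) = inv (f k)"
        using f closed by (simp add: inv_equality)
      then show ?thesis using \<psi> Pair by (cases b) (auto simp: letter_def gen_def)
    qed
    have \<psi>_abs: "\<psi> (abs_free_group w) = ev w" for w
    proof (induction w)
      case Nil
      then show ?case using one by (simp add: one_free_group.abs_eq)
    next
      case (Cons l w)
      have "abs_free_group (l # w) = abs_free_group [l] * abs_free_group w"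
        by (simp add: times_free_group.abs_eq)
      then show ?case using Cons by (simp add: mult letter)
    qed
    have "\<psi> x = \<phi> x" for x
      by (induction x) (simp add: \<phi>_abs \<psi>_abs)
    then show "\<psi> = \<phi>" by (rule ext)
  qed
qed

definition word_length :: "'r free_group \<Rightarrow> nat" where
  "word_length \<gamma> = (LEAST n. \<exists>w. length w = n \<and> abs_free_group w = \<gamma>)"

text \<open>The alphabet is a finite type \<open>'a\<close>; a configuration is a function on the free group.\<close>

type_synonym ('r, 'a) config = "'r free_group \<Rightarrow> 'a"

definition shift :: "'r free_group \<Rightarrow> ('r, 'a) config \<Rightarrow> ('r, 'a) config" where
  "shift g x = (\<lambda>h. x (h * g))"

text \<open>
  Borel sets for the product of the discrete topologies; \<open>'a\<close> carries no \<open>topological_space\<close>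
  instance, so \<open>borel\<close> is not available on this type.
\<close>

definition config_borel :: "('r, 'a) config measure" where
  "config_borel =
    sigma UNIV {U. openin (product_topology (\<lambda>_. discrete_topology UNIV) UNIV) U}"

definition invariant_prob :: "('r, 'a) config measure set" where
  "invariant_prob = {\<mu>. prob_space \<mu> \<and> sets \<mu> = sets config_borel \<and>
    (\<forall>g. distr \<mu> config_borel (shift g) = \<mu>)}"

definition config_dist :: "('r::finite, 'a) config \<Rightarrow> ('r, 'a) config \<Rightarrow> real" where
  "config_dist x y = (\<Sum>\<^sub>\<infinity>\<gamma>. (if x \<gamma> \<noteq> y \<gamma> then 1 else 0) *
    inverse (5 * real CARD('r) ^ 2) ^ word_length \<gamma>)"

text \<open>Without summability the infinite sum above would be \<open>0\<close> by convention.\<close>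

lemma config_dist_summable:
  "(\<lambda>\<gamma>::'r::finite free_group. (if x \<gamma> \<noteq> y \<gamma> then 1 else 0) *
    inverse (5 * real CARD('r) ^ 2) ^ word_length \<gamma>) summable_on UNIV"
proof -
  define c where "c = inverse (5 * real CARD('r) ^ 2)"
  have r: "real CARD('r) \<ge> 1" by (simp add: Suc_le_eq)
  have c: "c > 0" using r by (simp add: c_def)
  have q: "2 * real CARD('r) * c < 1"
  proof -
    have "2 * real CARD('r) < 5 * real CARD('r) ^ 2"
      using mult_left_mono[OF r, of "real CARD('r)"] r unfolding power2_eq_square by linarith
    then show ?thesis using r by (simp add: c_def divide_simps)
  qed
  have words: "\<exists>w. length w = word_length \<gamma> \<and> abs_free_group w = \<gamma>" for \<gamma> :: "'r free_group"
  proof -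
    have "\<exists>w. abs_free_group w = \<gamma>" by (induction \<gamma>) blast
    then have "\<exists>n w. length w = n \<and> abs_free_group w = \<gamma>" by blast
    from LeastI_ex[OF this] show ?thesis by (simp only: word_length_def)
  qed
  have level: "finite {\<gamma>::'r free_group. word_length \<gamma> = n} \<and>
      real (card {\<gamma>::'r free_group. word_length \<gamma> = n}) \<le> (2 * real CARD('r)) ^ n" for n
  proof -
    let ?W = "{w :: ('r \<times> bool) list. set w \<subseteq> UNIV \<and> length w = n}"
    have sub: "{\<gamma>::'r free_group. word_length \<gamma> = n} \<subseteq> abs_free_group ` ?W"
    proof
      fix \<gamma> :: "'r free_group" assume "\<gamma> \<in> {\<gamma>. word_length \<gamma> = n}"
      with words[of \<gamma>] show "\<gamma> \<in> abs_free_group ` ?W" by auto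
    qed
    have fin: "finite ?W" by (rule finite_lists_length_eq) simp
    have "card {\<gamma>::'r free_group. word_length \<gamma> = n} \<le> card ?W"
      using sub fin by (meson card_image_le card_mono finite_imageI le_trans)
    also have "\<dots> = (2 * CARD('r)) ^ n"
      by (subst card_lists_length_eq) (simp_all add: card_cartesian_product mult.commute)
    finally have "real (card {\<gamma>::'r free_group. word_length \<gamma> = n}) \<le> real ((2 * CARD('r)) ^ n)"
      by (rule of_nat_mono)
    then show ?thesis using finite_subset[OF sub finite_imageI[OF fin]] by simp
  qed
  have "(\<lambda>\<gamma>::'r free_group. c ^ word_length \<gamma>) summable_on UNIV"
  proof (rule nonneg_bdd_above_summable_on)
    show "bdd_above (sum (\<lambda>\<gamma>::'r free_group. c ^ word_length \<gamma>) ` {F. F \<subseteq> UNIV \<and> finite F})"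
    proof (rule bdd_aboveI2)
      fix F :: "'r free_group set" assume "F \<in> {F. F \<subseteq> UNIV \<and> finite F}"
      then have F: "finite F" by simp
      define N where "N = Max (insert 0 (word_length ` F))"
      have N: "word_length ` F \<subseteq> {..N}" using F by (auto simp: N_def)
      have "(\<Sum>\<gamma>\<in>F. c ^ word_length \<gamma>) = (\<Sum>n\<le>N. \<Sum>\<gamma>\<in>{\<gamma>\<in>F. word_length \<gamma> = n}. c ^ word_length \<gamma>)"
        by (rule sum.group[symmetric]) (use F N in auto)
      also have "\<dots> = (\<Sum>n\<le>N. real (card {\<gamma>\<in>F. word_length \<gamma> = n}) * c ^ n)"
        by simp
      also have "\<dots> \<le> (\<Sum>n\<le>N. (2 * real CARD('r) * c) ^ n)"
      proof (rule sum_mono)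
        fix n
        have "card {\<gamma>\<in>F. word_length \<gamma> = n} \<le> card {\<gamma>::'r free_group. word_length \<gamma> = n}"
          using level by (intro card_mono) auto
        then have "real (card {\<gamma>\<in>F. word_length \<gamma> = n}) \<le> (2 * real CARD('r)) ^ n"
          using level[of n] by linarith
        then show "real (card {\<gamma>\<in>F. word_length \<gamma> = n}) * c ^ n \<le> (2 * real CARD('r) * c) ^ n"
          using c by (simp add: power_mult_distrib mult_right_mono)
      qed
      also have "\<dots> \<le> (\<Sum>n. (2 * real CARD('r) * c) ^ n)"
        by (rule sum_le_suminf) (use q c r in \<open>auto intro!: summable_geometric\<close>)
      finally show "(\<Sum>\<gamma>\<in>F. c ^ word_length \<gamma>) \<le> (\<Sum>n. (2 * real CARD('r) * c) ^ n)" .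
    qed
  qed (use c in auto)
  then show ?thesis
    unfolding c_def[symmetric]
    by (rule summable_on_comparison_test) (use c in auto)
qed

definition lipschitz1 :: "'b set \<Rightarrow> ('b \<Rightarrow> 'b \<Rightarrow> real) \<Rightarrow> ('b \<Rightarrow> real) \<Rightarrow> bool" where
  "lipschitz1 S d f \<longleftrightarrow> (\<forall>x\<in>S. \<forall>y\<in>S. \<bar>f x - f y\<bar> \<le> d x y)"

definition transport_dist ::
    "('r::finite, 'a) config measure \<Rightarrow> ('r, 'a) config measure \<Rightarrow> real" where
  "transport_dist \<mu> \<nu> =
    Sup {\<bar>(\<integral>x. f x \<partial>\<mu>) - (\<integral>x. f x \<partial>\<nu>)\<bar> | f. lipschitz1 UNIV config_dist f}"

text \<open>
  \<open>Hom V\<close> is the set of homomorphisms from the free group to the symmetric group of \<open>V\<close>.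
  Elements of \<open>BijGroup V\<close> are bijections of \<open>V\<close> that are \<open>undefined\<close> off \<open>V\<close>.
\<close>

definition Hom :: "'v set \<Rightarrow> ('r free_group \<Rightarrow> 'v \<Rightarrow> 'v) set" where
  "Hom V = hom free_grp (BijGroup V)"

definition pullback_name :: "('r free_group \<Rightarrow> 'v \<Rightarrow> 'v) \<Rightarrow> ('v \<Rightarrow> 'a) \<Rightarrow> 'v \<Rightarrow> ('r, 'a) config" where
  "pullback_name \<sigma> x v = (\<lambda>h. x (\<sigma> h v))"

definition empirical ::
    "'v set \<Rightarrow> ('r free_group \<Rightarrow> 'v \<Rightarrow> 'v) \<Rightarrow> ('v \<Rightarrow> 'a) \<Rightarrow> ('r, 'a) config measure" where
  "empirical V \<sigma> x = distr (uniform_count_measure V) config_borel (pullback_name \<sigma> x)"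

lemma empirical_eq_sum_dirac:
  assumes "finite V" "V \<noteq> {}" and E: "E \<in> sets config_borel"
  shows "measure (empirical V \<sigma> x) E =
    (1 / card V) * (\<Sum>v\<in>V. measure (return config_borel (pullback_name \<sigma> x v)) E)"
proof -
  have sp: "space config_borel = UNIV" by (simp add: config_borel_def)
  have meas: "pullback_name \<sigma> x \<in> measurable (uniform_count_measure V) config_borel"
    by (auto simp: measurable_def sp space_uniform_count_measure sets_uniform_count_measure)
  have "measure (empirical V \<sigma> x) E = measure (uniform_count_measure V) {v\<in>V. pullback_name \<sigma> x v \<in> E}"
    using meas E by (simp add: empirical_def measure_distr space_uniform_count_measure
        vimage_def Int_def conj_commute)
  also have "\<dots> = card {v\<in>V. pullback_name \<sigma> x v \<in> E} / card V"
    using assms by (subst measure_uniform_count_measure) auto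
  also have "real (card {v\<in>V. pullback_name \<sigma> x v \<in> E}) =
      (\<Sum>v\<in>V. measure (return config_borel (pullback_name \<sigma> x v)) E)"
    using assms E by (simp add: measure_return indicator_def sum.If_cases Int_def)
  finally show ?thesis by simp
qed

definition good_models :: "'v set \<Rightarrow> ('r::finite free_group \<Rightarrow> 'v \<Rightarrow> 'v) \<Rightarrow>
    ('r, 'a) config measure \<Rightarrow> real \<Rightarrow> ('v \<Rightarrow> 'a) set" where
  "good_models V \<sigma> \<mu> \<epsilon> = {x \<in> V \<rightarrow>\<^sub>E UNIV. transport_dist (empirical V \<sigma> x) \<mu> < \<epsilon>}"

definition sofic_at :: "'v set \<Rightarrow> 'r free_group set \<Rightarrow> real \<Rightarrow> ('r free_group \<Rightarrow> 'v \<Rightarrow> 'v) \<Rightarrow> bool" where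
  "sofic_at V F \<delta> \<sigma> \<longleftrightarrow>
    real (card {v\<in>V. \<forall>\<gamma>1\<in>F. \<forall>\<gamma>2\<in>F. \<gamma>1 \<noteq> \<gamma>2 \<longrightarrow> \<sigma> \<gamma>1 v \<noteq> \<sigma> \<gamma>2 v}) / real (card V) > 1 - \<delta>"

text \<open>The library's real \<open>ln\<close> has \<open>ln 0 = 0\<close>; here \<open>log 0 = -\<infinity>\<close>.\<close>

definition elog :: "real \<Rightarrow> ereal" where
  "elog x = (if x \<le> 0 then -\<infinity> else ereal (ln x))"

text \<open>
  A random homomorphism \<open>\<sigma> n\<close> is a random variable on its own probability space \<open>M n\<close>.
\<close>

definition random_sofic_approx ::
    "(nat \<Rightarrow> 'w measure) \<Rightarrow> (nat \<Rightarrow> 'v set) \<Rightarrow> (nat \<Rightarrow> 'w \<Rightarrow> 'r free_group \<Rightarrow> 'v \<Rightarrow> 'v) \<Rightarrow> bool" where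
  "random_sofic_approx M V \<sigma> \<longleftrightarrow>
    (\<forall>n. prob_space (M n) \<and> finite (V n) \<and> V n \<noteq> {} \<and>
      \<sigma> n \<in> measurable (M n) (count_space (Hom (V n)))) \<and>
    (\<forall>F \<delta>. finite F \<longrightarrow> \<delta> > 0 \<longrightarrow>
      limsup (\<lambda>n. ereal (1 / real (card (V n))) *
        elog (measure (M n) {\<omega> \<in> space (M n). \<not> sofic_at (V n) F \<delta> (\<sigma> n \<omega>)})) = -\<infinity>)"

definition differ_by_switching ::
    "'v set \<Rightarrow> ('r free_group \<Rightarrow> 'v \<Rightarrow> 'v) \<Rightarrow> ('r free_group \<Rightarrow> 'v \<Rightarrow> 'v) \<Rightarrow> bool" where
  "differ_by_switching V \<sigma>1 \<sigma>2 \<longleftrightarrow> \<sigma>1 \<in> Hom V \<and> \<sigma>2 \<in> Hom V \<and>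
    (\<exists>i\<in>V. \<exists>j\<in>V. \<exists>k. \<sigma>1 (gen k) i = \<sigma>2 (gen k) j \<and> \<sigma>1 (gen k) j = \<sigma>2 (gen k) i \<and>
      (\<forall>l. \<forall>v\<in>V. (l, v) \<notin> {(k, i), (k, j)} \<longrightarrow> \<sigma>1 (gen l) v = \<sigma>2 (gen l) v))"

text \<open>
  On \<open>Hom V\<close> with \<open>V\<close> finite the minimum exists, since transpositions generate the symmetric group.
\<close>

definition hom_dist ::
    "'v set \<Rightarrow> ('r free_group \<Rightarrow> 'v \<Rightarrow> 'v) \<Rightarrow> ('r free_group \<Rightarrow> 'v \<Rightarrow> 'v) \<Rightarrow> real" where
  "hom_dist V \<sigma>1 \<sigma>2 = real (LEAST m. (differ_by_switching V ^^ m) \<sigma>1 \<sigma>2) / real (card V)"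

definition exp_concentrated ::
    "(nat \<Rightarrow> 'w measure) \<Rightarrow> (nat \<Rightarrow> 'v set) \<Rightarrow> (nat \<Rightarrow> 'w \<Rightarrow> 'r free_group \<Rightarrow> 'v \<Rightarrow> 'v) \<Rightarrow> bool" where
  "exp_concentrated M V \<sigma> \<longleftrightarrow>
    (\<exists>C>0. \<forall>n f t. lipschitz1 (Hom (V n)) (hom_dist (V n)) f \<longrightarrow> t > 0 \<longrightarrow>
      measure (M n) {\<omega> \<in> space (M n). \<bar>f (\<sigma> n \<omega>) - (\<integral>\<omega>'. f (\<sigma> n \<omega>') \<partial>M n)\<bar> > t}
        \<le> 2 * exp (- C * real (card (V n)) * t\<^sup>2))"

definition annealed_rate ::
    "(nat \<Rightarrow> 'w measure) \<Rightarrow> (nat \<Rightarrow> 'v set) \<Rightarrow> (nat \<Rightarrow> 'w \<Rightarrow> 'r::finite free_group \<Rightarrow> 'v \<Rightarrow> 'v) \<Rightarrow>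
      ('r, 'a) config measure \<Rightarrow> real \<Rightarrow> nat \<Rightarrow> ereal" where
  "annealed_rate M V \<sigma> \<mu> \<epsilon> n = ereal (1 / real (card (V n))) *
    elog (\<integral>\<omega>. real (card (good_models (V n) (\<sigma> n \<omega>) \<mu> \<epsilon>)) \<partial>M n)"

definition upper_annealed_entropy ::
    "(nat \<Rightarrow> 'w measure) \<Rightarrow> (nat \<Rightarrow> 'v set) \<Rightarrow> (nat \<Rightarrow> 'w \<Rightarrow> 'r::finite free_group \<Rightarrow> 'v \<Rightarrow> 'v) \<Rightarrow>
      ('r, 'a) config measure \<Rightarrow> ereal" where
  "upper_annealed_entropy M V \<sigma> \<mu> = (INF \<epsilon>\<in>{0<..}. limsup (annealed_rate M V \<sigma> \<mu> \<epsilon>))"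

definition lower_annealed_entropy ::
    "(nat \<Rightarrow> 'w measure) \<Rightarrow> (nat \<Rightarrow> 'v set) \<Rightarrow> (nat \<Rightarrow> 'w \<Rightarrow> 'r::finite free_group \<Rightarrow> 'v \<Rightarrow> 'v) \<Rightarrow>
      ('r, 'a) config measure \<Rightarrow> ereal" where
  "lower_annealed_entropy M V \<sigma> \<mu> = (INF \<epsilon>\<in>{0<..}. liminf (annealed_rate M V \<sigma> \<mu> \<epsilon>))"

text \<open>
  For \<open>V\<close> finite and nonempty, \<open>0 \<le> h \<le> ln CARD('a)\<close> and an invariant probability measure \<open>\<mu>\<close>,
  the set below is nonempty because \<open>transport_dist\<close> is bounded.
\<close>

definition rho :: "'v set \<Rightarrow> ('r::finite free_group \<Rightarrow> 'v \<Rightarrow> 'v) \<Rightarrow>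
    ('r, 'a) config measure \<Rightarrow> real \<Rightarrow> real" where
  "rho V \<sigma> \<mu> h = Inf {\<epsilon>. \<epsilon> > 0 \<and>
    ereal (1 / real (card V)) * elog (real (card (good_models V \<sigma> \<mu> \<epsilon>))) \<ge> ereal h}"

definition upper_rho ::
    "(nat \<Rightarrow> 'w measure) \<Rightarrow> (nat \<Rightarrow> 'v set) \<Rightarrow> (nat \<Rightarrow> 'w \<Rightarrow> 'r::finite free_group \<Rightarrow> 'v \<Rightarrow> 'v) \<Rightarrow>
      ('r, 'a) config measure \<Rightarrow> real \<Rightarrow> ereal" where
  "upper_rho M V \<sigma> \<mu> h = limsup (\<lambda>n. ereal (\<integral>\<omega>. rho (V n) (\<sigma> n \<omega>) \<mu> h \<partial>M n))"

definition lower_rho ::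
    "(nat \<Rightarrow> 'w measure) \<Rightarrow> (nat \<Rightarrow> 'v set) \<Rightarrow> (nat \<Rightarrow> 'w \<Rightarrow> 'r::finite free_group \<Rightarrow> 'v \<Rightarrow> 'v) \<Rightarrow>
      ('r, 'a) config measure \<Rightarrow> real \<Rightarrow> ereal" where
  "lower_rho M V \<sigma> \<mu> h = liminf (\<lambda>n. ereal (\<integral>\<omega>. rho (V n) (\<sigma> n \<omega>) \<mu> h \<partial>M n))"

definition h_flat ::
    "(nat \<Rightarrow> 'w measure) \<Rightarrow> (nat \<Rightarrow> 'v set) \<Rightarrow> (nat \<Rightarrow> 'w \<Rightarrow> 'r::finite free_group \<Rightarrow> 'v \<Rightarrow> 'v) \<Rightarrow>
      ('r, 'a::finite) config measure \<Rightarrow> ereal" where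
  "h_flat M V \<sigma> \<mu> = Sup {ereal h | h. h \<in> {0..ln (real CARD('a))} \<and> upper_rho M V \<sigma> \<mu> h = 0}"

definition h_sharp ::
    "(nat \<Rightarrow> 'w measure) \<Rightarrow> (nat \<Rightarrow> 'v set) \<Rightarrow> (nat \<Rightarrow> 'w \<Rightarrow> 'r::finite free_group \<Rightarrow> 'v \<Rightarrow> 'v) \<Rightarrow>
      ('r, 'a::finite) config measure \<Rightarrow> ereal" where
  "h_sharp M V \<sigma> \<mu> = Sup {ereal h | h. h \<in> {0..ln (real CARD('a))} \<and> lower_rho M V \<sigma> \<mu> h = 0}"

end

theory Submission
  imports Defs
begin

text \<open>
  The idea is a first-moment argument. Fix \<open>\<epsilon> > 0\<close>. If the mean of \<open>rho\<close> at level \<open>h\<close> is below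
  \<open>\<epsilon> / 2\<close>, then by Markov's inequality \<open>rho\<close> is below \<open>\<epsilon>\<close> with probability at least \<open>1 / 2\<close>.
  Whenever \<open>rho\<close> is below \<open>\<epsilon>\<close> there are at least \<open>exp (h * card V)\<close> good models at scale \<open>\<epsilon>\<close>,
  because good models only accumulate as the scale grows. Hence the expected number of good models
  is at least \<open>exp (h * card V) / 2\<close>, and the annealed rate is at least \<open>h - ln 2 / card V\<close>
  (\<open>annealed_rate_ge\<close>).

  The loss \<open>ln 2 / card V\<close> is asymptotically negligible: a finite set of more than \<open>card V\<close> group
  elements cannot act on \<open>V\<close> with distinct values at even a single vertex, so soficity for
  arbitrarily large finite sets forces \<open>card (V n)\<close> to tend to infinity (\<open>card_at_top\<close>). If the mean
  of \<open>rho\<close> has lower limit \<open>0\<close>, the bound holds for infinitely many \<open>n\<close> and controls the upper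
  annealed entropy; if its upper limit is \<open>0\<close>, the bound holds for all large \<open>n\<close> and controls the
  lower one.

  Markov's inequality requires \<open>rho\<close> to be nonnegative and integrable. As an infimum of reals this
  rests on the set of admissible scales being nonempty, which holds because the transportation
  distance is bounded by a constant depending on the rank only (\<open>transport_dist_bounded\<close>), so that
  at a large fixed scale every labelling is a good model.
\<close>

section \<open>Boundedness of the transportation distance\<close>

lemma config_dist_bounded:
  obtains D where "D \<ge> 0" "\<And>x y :: ('r::finite, 'a) config. config_dist x y \<le> D"
proof
  define c where "c = inverse (5 * real CARD('r) ^ 2)"
  define D where "D = (\<Sum>\<^sub>\<infinity>\<gamma>::'r free_group. c ^ word_length \<gamma>)"
  have c: "c \<ge> 0" by (simp add: c_def)
  have summable: "(\<lambda>\<gamma>::'r free_group. c ^ word_length \<gamma>) summable_on UNIV"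
    using config_dist_summable[where ?'r = 'r, of "\<lambda>_. True" "\<lambda>_. False"] by (simp add: c_def)
  show "D \<ge> 0" using c by (auto simp: D_def intro: infsum_nonneg)
  fix x y :: "('r, 'a) config"
  show "config_dist x y \<le> D"
    unfolding config_dist_def D_def c_def[symmetric]
    by (rule infsum_mono)
      (use config_dist_summable[of x y] summable c in \<open>auto simp: c_def\<close>)
qed

text \<open>
  On a probability space, the mean of a function with oscillation at most \<open>D\<close> lies within \<open>D\<close> of
  any of its values. A test function that is not measurable has integral \<open>0\<close> for every measure on
  the same \<open>\<sigma>\<close>-algebra, so it needs a separate, trivial treatment.
\<close>
lemma transport_dist_bounded:
  obtains B where "B \<ge> 0"
    "\<And>\<mu> \<nu> :: ('r::finite, 'a) config measure. prob_space \<mu> \<Longrightarrow> prob_space \<nu> \<Longrightarrow>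
      sets \<mu> = sets config_borel \<Longrightarrow> sets \<nu> = sets config_borel \<Longrightarrow> transport_dist \<mu> \<nu> \<le> B"
proof -
  obtain D where D: "D \<ge> 0" "\<And>x y :: ('r, 'a) config. config_dist x y \<le> D"
    by (rule config_dist_bounded) blast
  have near: "\<bar>(\<integral>x. f x \<partial>\<mu>) - f a\<bar> \<le> D"
    if \<mu>: "prob_space \<mu>" and f: "f \<in> borel_measurable \<mu>" and osc: "\<And>x. \<bar>f x - f a\<bar> \<le> D"
    for \<mu> :: "('r, 'a) config measure" and f a
  proof -
    interpret prob_space \<mu> by fact
    have "norm (f x) \<le> \<bar>f a\<bar> + D" for x
      using osc[of x] by simp
    then have int: "integrable \<mu> f"
      using f by (intro integrable_const_bound[where B = "\<bar>f a\<bar> + D"]) auto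
    have "(\<integral>x. f x \<partial>\<mu>) \<le> f a + D"
      using osc by (intro integral_le_const[OF int]) (auto simp: abs_le_iff algebra_simps)
    moreover have "f a - D \<le> (\<integral>x. f x \<partial>\<mu>)"
      using osc by (intro integral_ge_const[OF int] AE_I2) (auto simp: abs_le_iff algebra_simps)
    ultimately show ?thesis by simp
  qed
  show thesis
  proof (rule that[of "2 * D"])
    show "2 * D \<ge> 0" using D by simp
    fix \<mu> \<nu> :: "('r, 'a) config measure"
    assume prob: "prob_space \<mu>" "prob_space \<nu>"
      and sets: "sets \<mu> = sets config_borel" "sets \<nu> = sets config_borel"
    have "\<bar>(\<integral>x. f x \<partial>\<mu>) - (\<integral>x. f x \<partial>\<nu>)\<bar> \<le> 2 * D"
      if "lipschitz1 UNIV config_dist f" for f :: "('r, 'a) config \<Rightarrow> real"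
    proof (cases "f \<in> borel_measurable \<mu>")
      case True
      then have "f \<in> borel_measurable \<nu>"
        using sets by (simp cong: measurable_cong_sets)
      moreover have "\<bar>f x - f undefined\<bar> \<le> D" for x
        using that D(2)[of x undefined] by (auto simp: lipschitz1_def intro: order_trans)
      ultimately show ?thesis
        using near[OF prob(1) True, of undefined] near[OF prob(2), of f undefined] by fastforce
    next
      case False
      then have "f \<notin> borel_measurable \<nu>"
        using sets by (simp cong: measurable_cong_sets)
      with False have "\<not> integrable \<mu> f" "\<not> integrable \<nu> f" by auto
      then show ?thesis using D by (simp add: not_integrable_integral_eq)
    qed
    moreover have "lipschitz1 UNIV config_dist (\<lambda>_ :: ('r, 'a) config. 0)"
      by (auto simp: lipschitz1_def config_dist_def intro: infsum_nonneg)
    ultimately show "transport_dist \<mu> \<nu> \<le> 2 * D"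
      unfolding transport_dist_def by (intro cSup_least) auto
  qed
qed

lemma
  assumes "finite V" "V \<noteq> {}"
  shows prob_space_empirical: "prob_space (empirical V \<sigma> x)"
    and sets_empirical: "sets (empirical V \<sigma> x) = sets config_borel"
proof -
  have "pullback_name \<sigma> x \<in> measurable (uniform_count_measure V) config_borel"
    by (auto simp: measurable_def config_borel_def space_uniform_count_measure
        sets_uniform_count_measure)
  then show "prob_space (empirical V \<sigma> x)"
    unfolding empirical_def
    using assms by (intro prob_space.prob_space_distr prob_space_uniform_count_measure)
  show "sets (empirical V \<sigma> x) = sets config_borel"
    by (simp add: empirical_def)
qed

section \<open>Good models and the scale at which they abound\<close>

lemma good_models_mono: "\<epsilon> \<le> \<epsilon>' \<Longrightarrow> good_models V \<sigma> \<mu> \<epsilon> \<subseteq> good_models V \<sigma> \<mu> \<epsilon>'"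
  by (auto simp: good_models_def)

lemma card_good_models_mono:
  fixes \<mu> :: "('r::finite, 'a::finite) config measure"
  assumes "finite V" "\<epsilon> \<le> \<epsilon>'"
  shows "card (good_models V \<sigma> \<mu> \<epsilon>) \<le> card (good_models V \<sigma> \<mu> \<epsilon>')"
proof (rule card_mono[OF _ good_models_mono[OF assms(2)]])
  show "finite (good_models V \<sigma> \<mu> \<epsilon>')"
    by (rule finite_subset[OF _ finite_PiE[of V "\<lambda>_. UNIV :: 'a set"]])
      (use assms in \<open>auto simp: good_models_def\<close>)
qed

lemma card_good_models_le:
  fixes \<mu> :: "('r::finite, 'a::finite) config measure"
  assumes "finite V"
  shows "card (good_models V \<sigma> \<mu> \<epsilon>) \<le> CARD('a) ^ card V"
proof -
  have "card (good_models V \<sigma> \<mu> \<epsilon>) \<le> card (V \<rightarrow>\<^sub>E (UNIV :: 'a set))"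
    by (rule card_mono) (use assms in \<open>auto simp: good_models_def intro: finite_PiE\<close>)
  then show ?thesis using assms by (simp add: card_PiE)
qed

lemma elog_rate_ge_iff:
  assumes "m > 0"
  shows "ereal (1 / real m) * elog x \<ge> ereal h \<longleftrightarrow> x \<ge> exp (h * real m)"
proof (cases "x > 0")
  case True
  then have "exp (h * real m) \<le> x \<longleftrightarrow> h * real m \<le> ln x"
    by (simp add: ln_ge_iff)
  with True assms show ?thesis by (simp add: elog_def field_simps)
next
  case False
  then have "x < exp (h * real m)" by (rule order_le_less_trans[OF leI exp_gt_zero])
  with False assms show ?thesis by (simp add: elog_def)
qed

text \<open>
  At a scale beyond the bound on the transportation distance every labelling is good, and there are
  \<open>CARD('a) ^ card V\<close> of them; this is where \<open>h \<le> ln CARD('a)\<close> enters. So the infimum defining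
  \<open>rho\<close> is taken over a nonempty set, is at most this scale uniformly in the homomorphism, and can
  be approximated by admissible scales.
\<close>
lemma rho_bounded_and_many_good_models:
  fixes \<mu> :: "('r::finite, 'a::finite) config measure"
  assumes \<mu>: "\<mu> \<in> invariant_prob" and h: "h \<le> ln (real CARD('a))"
  obtains B where "\<And>(V :: 'v set) \<sigma>. finite V \<Longrightarrow> V \<noteq> {} \<Longrightarrow> 0 \<le> rho V \<sigma> \<mu> h \<and> rho V \<sigma> \<mu> h \<le> B"
    and "\<And>(V :: 'v set) \<sigma> \<epsilon>. finite V \<Longrightarrow> V \<noteq> {} \<Longrightarrow> rho V \<sigma> \<mu> h < \<epsilon> \<Longrightarrow>
      exp (h * real (card V)) \<le> real (card (good_models V \<sigma> \<mu> \<epsilon>))"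
proof -
  obtain B where B: "B \<ge> 0" "\<And>\<mu> \<nu> :: ('r, 'a) config measure. prob_space \<mu> \<Longrightarrow> prob_space \<nu> \<Longrightarrow>
      sets \<mu> = sets config_borel \<Longrightarrow> sets \<nu> = sets config_borel \<Longrightarrow> transport_dist \<mu> \<nu> \<le> B"
    by (rule transport_dist_bounded) blast
  define S where "S = (\<lambda>(V :: 'v set) \<sigma>. {\<epsilon>. \<epsilon> > 0 \<and>
    exp (h * real (card V)) \<le> real (card (good_models V \<sigma> \<mu> \<epsilon>))})"
  have rho_eq: "rho V \<sigma> \<mu> h = Inf (S V \<sigma>)" if "finite V" "V \<noteq> {}" for V \<sigma>
    using that by (simp add: rho_def S_def elog_rate_ge_iff card_gt_0_iff)
  have bdd: "bdd_below (S V \<sigma>)" for V \<sigma>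
    by (rule bdd_belowI[of _ 0]) (auto simp: S_def)
  have mem: "B + 1 \<in> S V \<sigma>" if V: "finite V" "V \<noteq> {}" for V \<sigma>
  proof -
    have "transport_dist (empirical V \<sigma> x) \<mu> < B + 1" for x
      using B(2)[of "empirical V \<sigma> x" \<mu>] prob_space_empirical[OF V, of \<sigma> x] \<mu>
      by (force simp: invariant_prob_def sets_empirical[OF V])
    then have "good_models V \<sigma> \<mu> (B + 1) = V \<rightarrow>\<^sub>E UNIV"
      by (auto simp: good_models_def)
    then have "real (card (good_models V \<sigma> \<mu> (B + 1))) = real CARD('a) ^ card V"
      using V by (simp add: card_PiE)
    also have "\<dots> = exp (ln (real CARD('a)) * real (card V))"
      by (simp add: exp_of_nat2_mult)
    finally show ?thesis using h B(1) by (simp add: S_def mult_right_mono)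
  qed
  show thesis
  proof (rule that[of "B + 1"])
    fix V :: "'v set" and \<sigma> :: "'r free_group \<Rightarrow> 'v \<Rightarrow> 'v" assume V: "finite V" "V \<noteq> {}"
    have "0 \<le> Inf (S V \<sigma>)"
      using mem[OF V, of \<sigma>] by (intro cInf_greatest) (auto simp: S_def)
    then show "0 \<le> rho V \<sigma> \<mu> h \<and> rho V \<sigma> \<mu> h \<le> B + 1"
      using cInf_lower[OF mem[OF V] bdd] rho_eq[OF V] by simp
    fix \<epsilon> assume "rho V \<sigma> \<mu> h < \<epsilon>"
    then obtain \<epsilon>' where "\<epsilon>' \<in> S V \<sigma>" "\<epsilon>' < \<epsilon>"
      using mem[OF V, of \<sigma>] bdd[of V \<sigma>] rho_eq[OF V] by (metis cInf_less_iff empty_iff)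
    then show "exp (h * real (card V)) \<le> real (card (good_models V \<sigma> \<mu> \<epsilon>))"
      using card_good_models_mono[OF V(1), of \<epsilon>' \<epsilon> \<sigma> \<mu>] by (simp add: S_def)
  qed
qed

section \<open>Soficity forces the vertex sets to grow\<close>

text \<open>The powers of a generator are told apart by a homomorphism to the integers.\<close>
lemma infinite_free_group: "infinite (UNIV :: 'r free_group set)"
proof -
  define G where "G = (\<lparr>carrier = UNIV, mult = (+), one = 0\<rparr> :: int monoid)"
  have "group G"
    by (rule groupI) (auto simp: G_def intro: exI[of _ "- _"])
  then obtain \<phi> where \<phi>: "\<phi> \<in> hom (free_grp :: 'r free_group monoid) G" "\<And>k. \<phi> (gen k) = 1"
    using free_grp_universal[of G "\<lambda>_ :: 'r. 1"] by (auto simp: G_def)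
  have mult: "\<phi> (x * y) = \<phi> x + \<phi> y" for x y
    using \<phi>(1) by (auto simp: hom_def free_grp_def G_def)
  have one: "\<phi> 1 = 0"
    using mult[of 1 1] by simp
  fix k :: 'r
  have "\<phi> (gen k ^ n) = int n" for n
    by (induction n) (auto simp: one mult \<phi>)
  then have "inj (\<lambda>n. gen k ^ n)"
    by (metis injI of_nat_eq_iff)
  then show ?thesis
    using finite_subset[OF subset_UNIV] range_inj_infinite by blast
qed

text \<open>Pigeonhole: more than \<open>card V\<close> group elements cannot move a vertex to distinct places.\<close>
lemma not_sofic_at_if_card_less:
  assumes V: "finite V" and \<sigma>: "\<sigma> \<in> Hom V" and card: "card V < card F"
  shows "\<not> sofic_at V F 1 \<sigma>"
proof -
  have maps: "\<sigma> \<gamma> v \<in> V" if "v \<in> V" for \<gamma> v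
    using \<sigma> that by (auto simp: Hom_def hom_def free_grp_def BijGroup_def Bij_def bij_betw_def)
  have no_vertex: "{v\<in>V. \<forall>\<gamma>1\<in>F. \<forall>\<gamma>2\<in>F. \<gamma>1 \<noteq> \<gamma>2 \<longrightarrow> \<sigma> \<gamma>1 v \<noteq> \<sigma> \<gamma>2 v} = {}"
  proof (rule ccontr)
    assume "\<not> ?thesis"
    then obtain v where "v \<in> V" "inj_on (\<lambda>\<gamma>. \<sigma> \<gamma> v) F"
      by (auto simp: inj_on_def)
    then have "card F \<le> card V"
      using V maps by (intro card_inj_on_le[of "\<lambda>\<gamma>. \<sigma> \<gamma> v"]) auto
    with card show False by simp
  qed
  show ?thesis unfolding sofic_at_def no_vertex by simp
qed

lemma card_at_top:
  fixes \<sigma> :: "nat \<Rightarrow> 'w \<Rightarrow> 'r free_group \<Rightarrow> 'v \<Rightarrow> 'v"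
  assumes approx: "random_sofic_approx M V \<sigma>"
  shows "filterlim (\<lambda>n. card (V n)) at_top sequentially"
  unfolding filterlim_at_top
proof
  fix N :: nat
  obtain F :: "'r free_group set" where F: "finite F" "card F = N"
    using infinite_free_group infinite_arbitrarily_large by blast
  let ?rate = "\<lambda>n. ereal (1 / real (card (V n))) *
    elog (measure (M n) {\<omega> \<in> space (M n). \<not> sofic_at (V n) F 1 (\<sigma> n \<omega>)})"
  have "limsup ?rate = -\<infinity>"
    using approx F by (simp add: random_sofic_approx_def)
  then have "eventually (\<lambda>n. ?rate n < 0) sequentially"
    using Limsup_lessD[of sequentially ?rate 0] by simp
  then show "eventually (\<lambda>n. N \<le> card (V n)) sequentially"
  proof eventually_elim
    case (elim n)
    show ?case
    proof (rule ccontr)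
      assume "\<not> N \<le> card (V n)"
      then have small: "card (V n) < card F" using F by simp
      have "finite (V n)" "prob_space (M n)"
        and meas: "\<sigma> n \<in> measurable (M n) (count_space (Hom (V n)))"
        using approx by (auto simp: random_sofic_approx_def)
      have "\<not> sofic_at (V n) F 1 (\<sigma> n \<omega>)" if "\<omega> \<in> space (M n)" for \<omega>
        using not_sofic_at_if_card_less[OF \<open>finite (V n)\<close> _ small] measurable_space[OF meas that]
        by simp
      then have "{\<omega> \<in> space (M n). \<not> sofic_at (V n) F 1 (\<sigma> n \<omega>)} = space (M n)"
        by blast
      then have "?rate n = 0"
        using \<open>prob_space (M n)\<close> by (simp add: prob_space.prob_space elog_def zero_ereal_def)
      with elim show False by simp
    qed
  qed
qed

section \<open>The first-moment bound\<close>

text \<open>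
  Markov's inequality turns a small mean of \<open>rho\<close> into probability at least \<open>1 / 2\<close> of having
  exponentially many good models; the logarithm of that factor is the loss \<open>ln 2 / card (V n)\<close>.
\<close>
lemma annealed_rate_ge:
  fixes \<sigma> :: "nat \<Rightarrow> 'w \<Rightarrow> 'r::finite free_group \<Rightarrow> 'v \<Rightarrow> 'v"
    and \<mu> :: "('r, 'a::finite) config measure"
  assumes approx: "random_sofic_approx M V \<sigma>" and \<mu>: "\<mu> \<in> invariant_prob"
    and h: "h \<le> ln (real CARD('a))" and \<epsilon>: "\<epsilon> > 0"
    and mean: "(\<integral>\<omega>. rho (V n) (\<sigma> n \<omega>) \<mu> h \<partial>M n) < \<epsilon> / 2"
  shows "ereal (h - ln 2 / real (card (V n))) \<le> annealed_rate M V \<sigma> \<mu> \<epsilon> n"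
proof -
  have V: "finite (V n)" "V n \<noteq> {}" and meas: "\<sigma> n \<in> measurable (M n) (count_space (Hom (V n)))"
    using approx by (auto simp: random_sofic_approx_def)
  interpret prob_space "M n"
    using approx by (simp add: random_sofic_approx_def)
  obtain B where rho: "\<And>\<tau>. 0 \<le> rho (V n) \<tau> \<mu> h" "\<And>\<tau>. rho (V n) \<tau> \<mu> h \<le> B"
    and many: "\<And>\<tau>. rho (V n) \<tau> \<mu> h < \<epsilon> \<Longrightarrow>
      exp (h * real (card (V n))) \<le> real (card (good_models (V n) \<tau> \<mu> \<epsilon>))"
    using rho_bounded_and_many_good_models[OF \<mu> h, where ?'v = 'v] V by (metis (no_types, lifting))
  have comp: "(\<lambda>\<omega>. g (\<sigma> n \<omega>)) \<in> borel_measurable (M n)"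
    for g :: "('r free_group \<Rightarrow> 'v \<Rightarrow> 'v) \<Rightarrow> real"
    by (rule measurable_compose[OF meas]) simp
  define m where "m = real (card (V n))"
  define R where "R = (\<lambda>\<omega>. rho (V n) (\<sigma> n \<omega>) \<mu> h)"
  define X where "X = (\<lambda>\<omega>. real (card (good_models (V n) (\<sigma> n \<omega>) \<mu> \<epsilon>)))"
  have int_R: "integrable (M n) R"
    using rho by (intro integrable_const_bound[where B = B]) (auto simp: R_def intro!: comp)
  have "real (card (good_models (V n) \<tau> \<mu> \<epsilon>)) \<le> real (CARD('a) ^ card (V n))" for \<tau>
    by (rule of_nat_mono[OF card_good_models_le[OF V(1)]])
  then have int_X: "integrable (M n) X"
    by (intro integrable_const_bound[where B = "real (CARD('a) ^ card (V n))"])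
      (auto simp: X_def intro!: comp)
  \<comment> \<open>Markov's inequality in integrand form: \<open>1 - R / \<epsilon>\<close> is a lower bound for the indicator
    of the event \<open>R < \<epsilon>\<close>.\<close>
  have "exp (h * m) * (1 - R \<omega> / \<epsilon>) \<le> X \<omega>" for \<omega>
  proof (cases "R \<omega> < \<epsilon>")
    case True
    have "exp (h * m) * (1 - R \<omega> / \<epsilon>) \<le> exp (h * m) * 1"
      using rho(1) \<epsilon> by (intro mult_left_mono) (auto simp: R_def)
    also have "\<dots> \<le> X \<omega>"
      using many True by (simp add: R_def X_def m_def)
    finally show ?thesis .
  next
    case False
    then have "exp (h * m) * (1 - R \<omega> / \<epsilon>) \<le> 0"
      using \<epsilon> by (intro mult_nonneg_nonpos) auto
    then show ?thesis by (rule order_trans) (simp add: X_def)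
  qed
  then have le: "(\<integral>\<omega>. exp (h * m) * (1 - R \<omega> / \<epsilon>) \<partial>M n) \<le> (\<integral>\<omega>. X \<omega> \<partial>M n)"
    using int_R int_X by (intro integral_mono) auto
  have "exp ((h - ln 2 / m) * m) = exp (h * m) * (1 / 2)"
    using V by (simp add: m_def card_gt_0_iff left_diff_distrib exp_diff)
  also have "\<dots> \<le> exp (h * m) * (1 - (\<integral>\<omega>. R \<omega> \<partial>M n) / \<epsilon>)"
    using mean \<epsilon> by (intro mult_left_mono) (auto simp: R_def field_simps)
  also have "\<dots> = (\<integral>\<omega>. exp (h * m) * (1 - R \<omega> / \<epsilon>) \<partial>M n)"
    using int_R prob_space by simp
  also note le
  finally have "exp ((h - ln 2 / m) * m) \<le> (\<integral>\<omega>. X \<omega> \<partial>M n)" .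
  then show ?thesis
    using V by (simp add: annealed_rate_def elog_rate_ge_iff card_gt_0_iff m_def X_def)
qed

lemma le_Limsup_if_frequently:
  fixes f :: "'b \<Rightarrow> ereal"
  assumes "\<exists>\<^sub>F x in F. c \<le> f x"
  shows "c \<le> Limsup F f"
proof (rule ccontr)
  assume "\<not> c \<le> Limsup F f"
  then have "eventually (\<lambda>x. f x < c) F" by (intro Limsup_lessD) simp
  with assms show False by (auto simp: frequently_def not_le)
qed

theorem lemma2p4:
  fixes M :: "nat \<Rightarrow> 'w measure"
    and V :: "nat \<Rightarrow> 'v set"
    and \<sigma> :: "nat \<Rightarrow> 'w \<Rightarrow> 'r::finite free_group \<Rightarrow> 'v \<Rightarrow> 'v"
    and \<mu> :: "('r, 'a::finite) config measure"
  assumes "random_sofic_approx M V \<sigma>"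
    and "exp_concentrated M V \<sigma>"
    and "\<mu> \<in> invariant_prob"
  shows "h_sharp M V \<sigma> \<mu> \<le> upper_annealed_entropy M V \<sigma> \<mu> \<and>
         h_flat M V \<sigma> \<mu> \<le> lower_annealed_entropy M V \<sigma> \<mu>"
proof -
  let ?mean = "\<lambda>h n. \<integral>\<omega>. rho (V n) (\<sigma> n \<omega>) \<mu> h \<partial>M n"
  let ?rate = "\<lambda>\<epsilon>. annealed_rate M V \<sigma> \<mu> \<epsilon>"
  have "(\<lambda>n. ln 2 / real (card (V n))) \<longlonglongrightarrow> 0"
    using card_at_top[OF assms(1)]
    by (intro tendsto_divide_0[OF tendsto_const] filterlim_at_top_imp_at_infinity
        filterlim_compose[OF filterlim_real_sequentially])
  then have loss: "eventually (\<lambda>n. ln 2 / real (card (V n)) < \<eta>) sequentially" if "\<eta> > 0" for \<eta>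
    using that by (rule order_tendstoD)
  have rate: "eventually (\<lambda>n. ?mean h n < \<epsilon> / 2 \<longrightarrow> ereal h' \<le> ?rate \<epsilon> n) sequentially"
    if h: "h \<le> ln (real CARD('a))" "h' < h" and \<epsilon>: "\<epsilon> > 0" for h h' \<epsilon>
  proof -
    have "eventually (\<lambda>n. ln 2 / real (card (V n)) < h - h') sequentially"
      using h by (intro loss) simp
    then show ?thesis
    proof eventually_elim
      case (elim n)
      show ?case
      proof
        assume "?mean h n < \<epsilon> / 2"
        from annealed_rate_ge[OF assms(1,3) h(1) \<epsilon> this] elim
        show "ereal h' \<le> ?rate \<epsilon> n" by (elim order_trans[rotated]) simp
      qed
    qed
  qed
  have below: "ereal h \<le> L" if "\<And>h'. h' < h \<Longrightarrow> ereal h' \<le> L" for h L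
  proof (rule ccontr)
    assume "\<not> ereal h \<le> L"
    then obtain h' where "L < ereal h'" "ereal h' < ereal h"
      using ereal_dense2[of L "ereal h"] by (auto simp: not_le)
    with that[of h'] show False by simp
  qed
  have "ereal h \<le> limsup (?rate \<epsilon>)"
    if h: "h \<le> ln (real CARD('a))" and 0: "lower_rho M V \<sigma> \<mu> h = 0" and \<epsilon>: "\<epsilon> > 0" for h \<epsilon>
  proof (rule below)
    fix h' assume "h' < h"
    have "\<exists>\<^sub>F n in sequentially. ?mean h n < \<epsilon> / 2"
    proof (rule ccontr)
      assume "\<not> ?thesis"
      then have "ereal (\<epsilon> / 2) \<le> lower_rho M V \<sigma> \<mu> h"
        unfolding lower_rho_def
        by (intro Liminf_bounded) (simp add: not_frequently not_less)
      with 0 \<epsilon> show False by (simp add: zero_ereal_def)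
    qed
    then have "\<exists>\<^sub>F n in sequentially. ereal h' \<le> ?rate \<epsilon> n"
      by (rule frequently_rev_mp) (rule rate[OF h \<open>h' < h\<close> \<epsilon>])
    then show "ereal h' \<le> limsup (?rate \<epsilon>)" by (rule le_Limsup_if_frequently)
  qed
  moreover have "ereal h \<le> liminf (?rate \<epsilon>)"
    if h: "h \<le> ln (real CARD('a))" and 0: "upper_rho M V \<sigma> \<mu> h = 0" and \<epsilon>: "\<epsilon> > 0" for h \<epsilon>
  proof (rule below)
    fix h' assume "h' < h"
    have "eventually (\<lambda>n. ereal (?mean h n) < ereal (\<epsilon> / 2)) sequentially"
      using 0 \<epsilon> by (intro Limsup_lessD) (simp add: upper_rho_def zero_ereal_def)
    with rate[OF h \<open>h' < h\<close> \<epsilon>]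
    have "eventually (\<lambda>n. ereal h' \<le> ?rate \<epsilon> n) sequentially"
      by eventually_elim simp
    then show "ereal h' \<le> liminf (?rate \<epsilon>)" by (rule Liminf_bounded)
  qed
  ultimately show ?thesis
    unfolding h_sharp_def h_flat_def upper_annealed_entropy_def lower_annealed_entropy_def
    by (auto intro!: Sup_least INF_greatest)
qed

end
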